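(* Let $X$ be a Hilbert space, let $\mathbf{\Omega}=\{\Omega_1,\ldots,\Omega_m\}$ ($m>1$) be a collection of closed subsets of $X$, and let $\bar x\in\bigcap_{i=1}^m\Omega_i$. Suppose $\mathbf{\Omega}$ is uniformly regular at $\bar x$ with $$\hat c[\mathbf{\Omega}](\bar x)<\frac1{m-1}$$ and $\Omega_1$ is super-regular at $\bar x$. Then, for any $c\in((m-1)\hat c[\mathbf{\Omega}](\bar x),1)$ with $c>0$, there exists $r>0$ such that every sequence $(x_k)_{k\ge0}$ generated by cyclic projections for $\mathbf{\Omega}$ with $\|x_0-\bar x\|<r$ and satisfying $$\|x_{km+i+1}-x_{km+i}\|\le\|x_{km+2}-x_{km+1}\|\quad(i=2,\ldots,m)$$ for each $k=0,1,\ldots$, linearly converges to some point in $\bigcap_{i=1}^m\Omega_i$ with rate $\sqrt[m]{c}$.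
   Context: $X$ is a Hilbert space with closed unit ball $\mathbb{B}$; $X^*$ is identified with $X$; $B_\delta(x)$ is the closed ball with center $x$ and radius $\delta$. Uniform regularity: $\mathbf{\Omega}$ is uniformly regular at $\bar x$ if there exist $\delta,\alpha>0$ such that $\bigcap_{i=1}^m(\Omega_i-\omega_i-a_i)\cap(\rho\mathbb{B})\neq\emptyset$ for all $\rho\in(0,\delta]$, $\omega_i\in\Omega_i\cap B_\delta(\bar x)$ and $a_i\in(\alpha\rho)\mathbb{B}$, $i=1,\ldots,m$. For $\Omega\subset X$ and $x\in\Omega$, the Fréchet normal cone is $N_\Omega(x)=\{x^*\in X\mid\limsup_{y\to x,\,y\in\Omega}\frac{\langle x^*,y-x\rangle}{\|y-x\|}\le0\}$ (equal to $X$ if $x$ is isolated in $\Omega$). For $\bar x\in\Omega$ and $\delta\ge0$, $\widehat N_\Omega(\bar x,\delta)=\bigcup_{x\in\Omega\cap B_\delta(\bar x)}N_\Omega(x)$. Constants: $$\hat\eta[\mathbf{\Omega}](\bar x)=\lim_{\delta\downarrow0}\inf\Big\{\Big\|\sum_{i=1}^m x_i^*\Big\|\ \Big|\ x_i^*\in\widehat N_{\Omega_i}(\bar x,\delta),\ \sum_{i=1}^m\|x_i^*\|=1\Big\},$$ where the infimum over the empty set equals $1$, and $\hat c[\mathbf{\Omega}](\bar x)=1-2(\hat\eta[\mathbf{\Omega}](\bar x))^2$. Projections: $P_\Omega(x)=\{\omega\in\Omega\mid\|x-\omega\|=d(x,\Omega)\}$ with $d(x,\Omega)=\inf_{\omega\in\Omega}\|x-\omega\|$.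 A sequence $(x_k)$ is generated by the cyclic projections for $\mathbf{\Omega}$ if $x_{k+1}\in P_{\Omega_{k+1}}(x_k)$ for $k=0,1,\ldots$, with the convention $\Omega_{i+nm}=\Omega_i$ for all $i=1,\ldots,m$ and $n\in\mathbb{N}$. Super-regularity: a closed set $\Omega$ is super-regular at $\bar x\in\Omega$ if, for any $\gamma>0$, any two points $x,z$ sufficiently close to $\bar x$ with $z\in\Omega$, and any point $y\in P_\Omega(x)$, it holds $\langle z-y,x-y\rangle\le\gamma\|z-y\|\cdot\|x-y\|$. A sequence $(x_k)$ linearly converges to $\tilde x$ with rate $q\in(0,1)$ if there is a constant $M\ge0$ such that $\|x_k-\tilde x\|\le Mq^k$ for all $k$. *)

theory Defs
  imports "HOL-Analysis.Analysis"
begin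

text \<open>A collection of \<open>m\<close> sets is a function \<open>\<Omega> :: nat \<Rightarrow> 'a set\<close> of which only the values
  at \<open>1, \<dots>, m\<close> are used.\<close>

definition uniformly_regular :: "nat \<Rightarrow> (nat \<Rightarrow> 'a::real_inner set) \<Rightarrow> 'a \<Rightarrow> bool" where
  "uniformly_regular m \<Omega> xbar \<longleftrightarrow>
     (\<exists>\<delta>>0. \<exists>\<alpha>>0. \<forall>\<rho>\<in>{0<..\<delta>}. \<forall>\<omega> a.
        (\<forall>i\<in>{1..m}. \<omega> i \<in> \<Omega> i \<inter> cball xbar \<delta> \<and> a i \<in> cball 0 (\<alpha> * \<rho>)) \<longrightarrow>
        (\<Inter>i\<in>{1..m}. (\<lambda>x. x - \<omega> i - a i) ` \<Omega> i) \<inter> cball 0 \<rho> \<noteq> {})"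

text \<open>If \<open>x\<close> is isolated in \<open>\<Omega>\<close>, the filter is trivial and the upper limit is \<open>-\<infinity>\<close>, so the
  cone is the whole space.\<close>

definition frechet_normal_cone :: "'a::real_inner set \<Rightarrow> 'a \<Rightarrow> 'a set" where
  "frechet_normal_cone \<Omega> x =
     {x'. Limsup (at x within \<Omega>) (\<lambda>y. ereal (inner x' (y - x) / norm (y - x))) \<le> 0}"

definition frechet_normals_near :: "'a::real_inner set \<Rightarrow> 'a \<Rightarrow> real \<Rightarrow> 'a set" where
  "frechet_normals_near \<Omega> xbar \<delta> = (\<Union>x\<in>\<Omega> \<inter> cball xbar \<delta>. frechet_normal_cone \<Omega> x)"

definition normal_sum_norms :: "nat \<Rightarrow> (nat \<Rightarrow> 'a::real_inner set) \<Rightarrow> 'a \<Rightarrow> real \<Rightarrow> real set" where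
  "normal_sum_norms m \<Omega> xbar \<delta> =
     {norm (\<Sum>i=1..m. x' i) | x'.
        (\<forall>i\<in>{1..m}. x' i \<in> frechet_normals_near (\<Omega> i) xbar \<delta>) \<and> (\<Sum>i=1..m. norm (x' i)) = 1}"

text \<open>By convention, the infimum over the empty set is 1.\<close>

definition eta_hat_at :: "nat \<Rightarrow> (nat \<Rightarrow> 'a::real_inner set) \<Rightarrow> 'a \<Rightarrow> real \<Rightarrow> real" where
  "eta_hat_at m \<Omega> xbar \<delta> =
     (if normal_sum_norms m \<Omega> xbar \<delta> = {} then 1 else Inf (normal_sum_norms m \<Omega> xbar \<delta>))"

definition eta_hat :: "nat \<Rightarrow> (nat \<Rightarrow> 'a::real_inner set) \<Rightarrow> 'a \<Rightarrow> real" where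
  "eta_hat m \<Omega> xbar = Lim (at_right 0) (eta_hat_at m \<Omega> xbar)"

definition c_hat :: "nat \<Rightarrow> (nat \<Rightarrow> 'a::real_inner set) \<Rightarrow> 'a \<Rightarrow> real" where
  "c_hat m \<Omega> xbar = 1 - 2 * (eta_hat m \<Omega> xbar)\<^sup>2"

text \<open>The limit defining \<^const>\<open>eta_hat\<close> always exists, since the infimum is bounded and
  monotone in \<open>\<delta>\<close>.\<close>

lemma normal_sum_norms_bounds:
  assumes "t \<in> normal_sum_norms m \<Omega> xbar \<delta>"
  shows "0 \<le> t" and "t \<le> 1"
  using assms by (auto simp: normal_sum_norms_def intro: order_trans[OF norm_sum])

lemma eta_hat_at_bounds: "0 \<le> eta_hat_at m \<Omega> xbar \<delta>" "eta_hat_at m \<Omega> xbar \<delta> \<le> 1"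
proof -
  let ?S = "normal_sum_norms m \<Omega> xbar \<delta>"
  have bdd: "bdd_below ?S"
    by (meson bdd_belowI normal_sum_norms_bounds(1))
  show "0 \<le> eta_hat_at m \<Omega> xbar \<delta>"
    by (auto simp: eta_hat_at_def intro: cInf_greatest normal_sum_norms_bounds(1))
  show "eta_hat_at m \<Omega> xbar \<delta> \<le> 1"
    using cInf_lower[OF _ bdd] normal_sum_norms_bounds(2)
    by (fastforce simp: eta_hat_at_def)
qed

lemma eta_hat_at_antimono:
  assumes "\<delta> \<le> \<delta>'"
  shows "eta_hat_at m \<Omega> xbar \<delta>' \<le> eta_hat_at m \<Omega> xbar \<delta>"
proof (cases "normal_sum_norms m \<Omega> xbar \<delta> = {}")
  case True
  then show ?thesis
    using eta_hat_at_bounds(2) by (simp add: eta_hat_at_def[of m \<Omega> xbar \<delta>])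
next
  case False
  have "frechet_normals_near (\<Omega> i) xbar \<delta> \<subseteq> frechet_normals_near (\<Omega> i) xbar \<delta>'" for i
    using assms by (force simp: frechet_normals_near_def)
  then have sub: "normal_sum_norms m \<Omega> xbar \<delta> \<subseteq> normal_sum_norms m \<Omega> xbar \<delta>'"
    unfolding normal_sum_norms_def by blast
  have "bdd_below (normal_sum_norms m \<Omega> xbar \<delta>')"
    by (meson bdd_belowI normal_sum_norms_bounds(1))
  then show ?thesis
    using False sub cInf_superset_mono[OF False _ sub] by (auto simp: eta_hat_at_def)
qed

lemma eta_hat_tendsto: "(eta_hat_at m \<Omega> xbar \<longlongrightarrow> eta_hat m \<Omega> xbar) (at_right 0)"
proof -
  let ?f = "eta_hat_at m \<Omega> xbar"
  let ?L = "SUP \<delta>\<in>{0<..}. ?f \<delta>"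
  have bdd: "bdd_above (?f ` {0<..})"
    by (auto intro!: bdd_aboveI2[of _ _ 1] eta_hat_at_bounds)
  have "(?f \<longlongrightarrow> ?L) (at_right 0)"
  proof (rule order_tendstoI)
    fix a assume "a < ?L"
    then obtain d where d: "d > 0" "a < ?f d"
      using less_cSUP_iff[OF _ bdd] by auto
    have "a < ?f \<delta>" if "0 < \<delta>" "\<delta> < d" for \<delta>
      using d(2) eta_hat_at_antimono[of \<delta> d m \<Omega> xbar] that by linarith
    then show "\<forall>\<^sub>F \<delta> in at_right 0. a < ?f \<delta>"
      using d(1) by (auto simp: eventually_at_right_field)
  next
    fix a assume "?L < a"
    then have "?f \<delta> < a" if "0 < \<delta>" for \<delta>
      using cSUP_upper[OF _ bdd, of \<delta>] that by auto
    then show "\<forall>\<^sub>F \<delta> in at_right 0. ?f \<delta> < a"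
      by (auto simp: eventually_at_right_field intro: exI[of _ 1])
  qed
  then show ?thesis
    unfolding eta_hat_def by (simp add: tendsto_Lim)
qed

definition projection :: "'a::real_inner set \<Rightarrow> 'a \<Rightarrow> 'a set" where
  "projection \<Omega> x = {\<omega> \<in> \<Omega>. dist x \<omega> = infdist x \<Omega>}"

text \<open>Under the periodic extension \<open>\<Omega> (i + n * m) = \<Omega> i\<close> of \<open>\<Omega> 1, \<dots>, \<Omega> m\<close>, the set with index
  \<open>k + 1\<close> is \<open>\<Omega> (k mod m + 1)\<close>.\<close>

definition cyclic_projections :: "nat \<Rightarrow> (nat \<Rightarrow> 'a::real_inner set) \<Rightarrow> (nat \<Rightarrow> 'a) \<Rightarrow> bool" where
  "cyclic_projections m \<Omega> x \<longleftrightarrow> (\<forall>k. x (k + 1) \<in> projection (\<Omega> (k mod m + 1)) (x k))"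

definition super_regular :: "'a::real_inner set \<Rightarrow> 'a \<Rightarrow> bool" where
  "super_regular \<Omega> xbar \<longleftrightarrow>
     (\<forall>\<gamma>>0. \<exists>\<delta>>0. \<forall>x\<in>ball xbar \<delta>. \<forall>z\<in>\<Omega> \<inter> ball xbar \<delta>. \<forall>y\<in>projection \<Omega> x.
        inner (z - y) (x - y) \<le> \<gamma> * norm (z - y) * norm (x - y))"

definition linearly_converges :: "(nat \<Rightarrow> 'a::real_normed_vector) \<Rightarrow> 'a \<Rightarrow> real \<Rightarrow> bool" where
  "linearly_converges x xtilde q \<longleftrightarrow>
     0 < q \<and> q < 1 \<and> (\<exists>M\<ge>0. \<forall>k. norm (x k - xtilde) \<le> M * q ^ k)"

end

theory Submission
  imports Defs
begin

text \<open>
  If \<open>u\<close> and \<open>v\<close> are unit normals to two different sets of the collection at points near \<open>xbar\<close>,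
  then testing \<open>eta_hat\<close> with \<open>u / 2\<close> and \<open>v / 2\<close> gives \<open>-\<langle>u, v\<rangle> \<le> \<kappa> := c / (m - 1)\<close>.
  A step \<open>x j \<rightarrow> x (j + 1)\<close> of the cyclic projections points opposite to a normal to a set of the
  collection; if this set is not \<open>\<Omega> 2\<close>, the distance to \<open>\<Omega> 2\<close> grows along the step at rate at most \<open>\<kappa>\<close>,
  because the derivative of the distance function is a pairing with a unit normal to \<open>\<Omega> 2\<close>.
  The \<open>m - 1\<close> steps from \<open>\<Omega> 2\<close> back to \<open>\<Omega> 1\<close> are no longer than the step from \<open>\<Omega> 1\<close> to
  \<open>\<Omega> 2\<close> which precedes them, so the next step from \<open>\<Omega> 1\<close> to \<open>\<Omega> 2\<close>, whose length is a distance to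
  \<open>\<Omega> 2\<close>, is shorter by the factor \<open>(m - 1) \<kappa> = c\<close>.
\<close>

section \<open>Sequences with geometrically decreasing steps\<close>

text \<open>Telescoping of a geometric sum. The step bound is required only between \<open>n\<close>
  and \<open>p\<close>, because the main induction uses it while later steps are not yet
  controlled.\<close>

lemma dist_le_of_geometric_steps:
  fixes x :: "nat \<Rightarrow> 'a::metric_space"
  assumes "0 \<le> C" "0 \<le> q" "q < 1" "n \<le> p"
    and "\<And>i. n \<le> i \<Longrightarrow> i < p \<Longrightarrow> dist (x i) (x (Suc i)) \<le> C * q ^ i"
  shows "dist (x n) (x p) \<le> C * q ^ n / (1 - q)"
proof -
  have "dist (x n) (x p) \<le> C * (q ^ n - q ^ p) / (1 - q)"
    using assms(4,5)
  proof (induction p rule: dec_induct)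
    case base
    then show ?case by simp
  next
    case (step p)
    have "dist (x n) (x (Suc p)) \<le> dist (x n) (x p) + dist (x p) (x (Suc p))"
      by (rule dist_triangle)
    also have "\<dots> \<le> C * (q ^ n - q ^ p) / (1 - q) + C * q ^ p"
      using step by (intro add_mono) auto
    also have "\<dots> = C * (q ^ n - q ^ Suc p) / (1 - q)"
      using assms(3) by (simp add: field_simps)
    finally show ?case .
  qed
  also have "\<dots> \<le> C * q ^ n / (1 - q)"
    using assms by (intro divide_right_mono mult_left_mono) auto
  finally show ?thesis .
qed

lemma geometric_steps_convergent:
  fixes x :: "nat \<Rightarrow> 'a::complete_space"
  assumes "0 \<le> C" "0 \<le> q" "q < 1"
    and steps: "\<And>i. dist (x i) (x (Suc i)) \<le> C * q ^ i"
  obtains l where "x \<longlonglongrightarrow> l" "\<And>n. dist (x n) l \<le> C * q ^ n / (1 - q)"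
proof -
  have bound: "dist (x n) (x p) \<le> C * q ^ n / (1 - q)" if "n \<le> p" for n p
    using assms that by (intro dist_le_of_geometric_steps) auto
  have lim0: "(\<lambda>n. C * q ^ n / (1 - q)) \<longlonglongrightarrow> C * 0 / (1 - q)"
    using assms by (intro tendsto_intros LIMSEQ_power_zero) auto
  have "Cauchy x"
  proof (rule metric_CauchyI)
    fix e :: real assume "e > 0"
    then have "\<forall>\<^sub>F n in sequentially. C * q ^ n / (1 - q) < e / 2"
      using order_tendstoD(2)[OF lim0, of "e / 2"] by simp
    then obtain N where N: "C * q ^ N / (1 - q) < e / 2"
      by (auto simp: eventually_sequentially)
    have "dist (x a) (x b) < e" if "N \<le> a" "N \<le> b" for a b
      using bound[OF that(1)] bound[OF that(2)] N dist_triangle3[of "x a" "x b" "x N"] by linarith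
    then show "\<exists>M. \<forall>a\<ge>M. \<forall>b\<ge>M. dist (x a) (x b) < e" by blast
  qed
  then obtain l where l: "x \<longlonglongrightarrow> l"
    using Cauchy_convergent_iff convergent_def by blast
  have "dist (x n) l \<le> C * q ^ n / (1 - q)" for n
  proof (rule tendsto_upperbound)
    show "((\<lambda>p. dist (x n) (x p)) \<longlongrightarrow> dist (x n) l) sequentially"
      by (intro tendsto_intros l)
    show "\<forall>\<^sub>F p in sequentially. dist (x n) (x p) \<le> C * q ^ n / (1 - q)"
      using bound by (auto simp: eventually_sequentially)
  qed simp
  with l show thesis by (rule that)
qed

section \<open>Density of the points that have a nearest point\<close>

text \<open>The tolerance is on squared distances to match \<open>stewart_identity\<close>; doing no
  worse than the given \<open>b\<close> later keeps the residuals from growing. If \<open>b\<close>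
  is itself nearest it is kept; otherwise both required bounds lie strictly above the
  infimum.\<close>

lemma infdist_square_approx:
  fixes \<Omega> :: "'a::real_inner set"
  assumes "b \<in> \<Omega>" "e > 0"
  obtains b' where "b' \<in> \<Omega>" "(norm (y - b'))\<^sup>2 \<le> (infdist y \<Omega>)\<^sup>2 + e" "norm (y - b') \<le> norm (y - b)"
proof (cases "norm (y - b) \<le> infdist y \<Omega>")
  case True
  then have "(norm (y - b))\<^sup>2 \<le> (infdist y \<Omega>)\<^sup>2"
    by (intro power_mono) auto
  with assms that[of b] show thesis by auto
next
  case False
  define R where "R = min (norm (y - b)) (sqrt ((infdist y \<Omega>)\<^sup>2 + e))"
  have "infdist y \<Omega> < sqrt ((infdist y \<Omega>)\<^sup>2 + e)"
    using assms by (intro real_less_rsqrt) auto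
  with False have "infdist y \<Omega> < R" by (simp add: R_def)
  moreover have "bdd_below (dist y ` \<Omega>)" by (auto intro: bdd_belowI)
  ultimately obtain b' where b': "b' \<in> \<Omega>" "dist y b' < R"
    using assms(1) by (auto simp: infdist_def cINF_less_iff split: if_splits)
  have "norm (y - b') \<le> sqrt ((infdist y \<Omega>)\<^sup>2 + e)"
    using b' by (simp add: R_def dist_norm)
  then have "(norm (y - b'))\<^sup>2 \<le> (sqrt ((infdist y \<Omega>)\<^sup>2 + e))\<^sup>2"
    by (intro power_mono) auto
  with b' assms that[of b'] show thesis
    by (auto simp: R_def dist_norm)
qed

text \<open>Stewart's theorem, solved for the distance from the endpoint \<open>b\<close> to
  \<open>z\<close>. With \<open>z\<close> the next almost nearest point, the other terms can be
  compared with the current residual.\<close>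

lemma stewart_identity:
  fixes a b z :: "'a::real_inner"
  shows "l * (norm (b - z))\<^sup>2 =
    (norm (a + l *\<^sub>R (b - a) - z))\<^sup>2 - (1 - l) * (norm (a - z))\<^sup>2 + l * (1 - l) * (norm (a - b))\<^sup>2"
  by (simp add: power2_norm_eq_inner inner_simps inner_commute algebra_simps)

text \<open>Points with a nearest point in \<open>\<Omega>\<close> are dense. Moving from \<open>u\<close> slightly towards an almost
  nearest point \<open>b\<close> forces all almost nearest points of the new \<open>u\<close> to be close to \<open>b\<close>;
  iterating with geometrically decreasing tolerances makes both sequences Cauchy.\<close>

lemma exists_projection_near:
  fixes \<Omega> :: "'a::{real_inner,complete_space} set"
  assumes "closed \<Omega>" "\<Omega> \<noteq> {}" "\<epsilon> > 0"
  obtains z p where "dist y z \<le> \<epsilon>" "p \<in> projection \<Omega> z"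
proof -
  define d where "d = infdist y \<Omega>"
  \<comment> \<open>The points move by at most \<open>2 * l * r 0\<close> in total and
    \<open>r 0 \<le> d + 1\<close>, so this \<open>l\<close> keeps their limit within
    \<open>\<epsilon>\<close> of \<open>y\<close>; \<open>l \<le> 1\<close> keeps every move inside
    the segment towards \<open>b\<close>.\<close>
  define l where "l = min 1 (\<epsilon> / (2 * (d + 1)))"
  have d: "d \<ge> 0" by (simp add: d_def infdist_nonneg)
  have "l \<le> \<epsilon> / (2 * (d + 1))" by (simp add: l_def)
  moreover have "2 * (d + 1) > 0" using d by simp
  ultimately have "l * (2 * (d + 1)) \<le> \<epsilon>" by (simp only: pos_le_divide_eq)
  moreover have "0 < l" "l \<le> 1" using d assms(3) by (simp_all add: l_def)
  ultimately have l: "0 < l" "l \<le> 1" "l * (2 * (d + 1)) \<le> \<epsilon>" by blast+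
  \<comment> \<open>The ratio 1/8 makes \<open>e n\<close> equal to \<open>\<mu> n\<close> times the
    square of \<open>(1 / 2) ^ n\<close>; dividing by \<open>\<mu> n\<close> below leaves a summable
    bound on the movement of \<open>b\<close>.\<close>
  define e where "e n = l * (1 / 8) ^ n" for n :: nat
  have e: "e n > 0" for n using l by (simp add: e_def)
  define P where "P n s \<longleftrightarrow> snd s \<in> \<Omega> \<and> (norm (fst s - snd s))\<^sup>2 \<le> (infdist (fst s) \<Omega>)\<^sup>2 + e n
      \<and> (n = 0 \<longrightarrow> fst s = y)" for n and s :: "'a \<times> 'a"
  define Q where "Q n s t \<longleftrightarrow> fst t = fst s + (l * (1 / 2) ^ n) *\<^sub>R (snd s - fst s)
      \<and> norm (fst t - snd t) \<le> norm (fst t - snd s)" for n :: nat and s t :: "'a \<times> 'a"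
  have "\<exists>f. \<forall>n. P n (f n) \<and> Q n (f n) (f (Suc n))"
  proof (rule dependent_nat_choice)
    obtain b where "b \<in> \<Omega>" using assms(2) by blast
    obtain b' where "b' \<in> \<Omega>" "(norm (y - b'))\<^sup>2 \<le> (infdist y \<Omega>)\<^sup>2 + e 0"
      by (rule infdist_square_approx[OF \<open>b \<in> \<Omega>\<close> e])
    then show "\<exists>s. P 0 s" by (intro exI[of _ "(y, b')"]) (simp add: P_def)
  next
    fix s n assume "P n s"
    then have "snd s \<in> \<Omega>" by (simp add: P_def)
    obtain b' where "b' \<in> \<Omega>"
      "(norm (fst s + (l * (1 / 2) ^ n) *\<^sub>R (snd s - fst s) - b'))\<^sup>2
        \<le> (infdist (fst s + (l * (1 / 2) ^ n) *\<^sub>R (snd s - fst s)) \<Omega>)\<^sup>2 + e (Suc n)"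
      "norm (fst s + (l * (1 / 2) ^ n) *\<^sub>R (snd s - fst s) - b')
        \<le> norm (fst s + (l * (1 / 2) ^ n) *\<^sub>R (snd s - fst s) - snd s)"
      by (rule infdist_square_approx[OF \<open>snd s \<in> \<Omega>\<close> e])
    then show "\<exists>t. P (Suc n) t \<and> Q n s t"
      by (intro exI[of _ "(fst s + (l * (1 / 2) ^ n) *\<^sub>R (snd s - fst s), b')"])
        (simp add: P_def Q_def)
  qed
  then obtain f where f: "\<And>n. P n (f n)" "\<And>n. Q n (f n) (f (Suc n))" by blast
  define u where "u n = fst (f n)" for n
  define b where "b n = snd (f n)" for n
  define r where "r n = norm (u n - b n)" for n
  define \<mu> where "\<mu> n = l * (1 / 2) ^ n" for n :: nat
  have \<mu>: "0 < \<mu> n" "\<mu> n \<le> 1" for n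
    using l mult_mono[of l 1 "(1/2) ^ n" 1] by (auto simp: \<mu>_def power_le_one)
  have b: "b n \<in> \<Omega>" and r: "(r n)\<^sup>2 \<le> (infdist (u n) \<Omega>)\<^sup>2 + e n" for n
    using f(1)[of n] by (simp_all add: P_def u_def b_def r_def)
  have u0: "u 0 = y" using f(1)[of 0] by (simp add: P_def u_def)
  have u: "u (Suc n) = u n + \<mu> n *\<^sub>R (b n - u n)"
    and rb: "r (Suc n) \<le> norm (u (Suc n) - b n)" for n
    using f(2)[of n] unfolding Q_def u_def b_def r_def \<mu>_def by blast+
  have ub: "norm (u (Suc n) - b n) = (1 - \<mu> n) * r n" for n
  proof -
    have "u (Suc n) - b n = (1 - \<mu> n) *\<^sub>R (u n - b n)"
      by (simp add: u algebra_simps)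
    then show ?thesis using \<mu>[of n] by (simp add: r_def)
  qed
  have r_nonneg: "0 \<le> r n" for n by (simp add: r_def)
  have r_decr: "r n \<le> r 0" for n
  proof (induction n)
    case (Suc n)
    have "(1 - \<mu> n) * r n \<le> 1 * r n"
      using \<mu>[of n] r_nonneg by (intro mult_right_mono) auto
    with Suc rb[of n] ub[of n] show ?case by simp
  qed simp
  have "(r 0)\<^sup>2 \<le> (d + 1)\<^sup>2"
    using r[of 0] l d by (simp add: u0 d_def e_def power2_eq_square algebra_simps)
  then have r0: "r 0 \<le> d + 1"
    using d by (intro power2_le_imp_le[of "r 0" "d + 1"]) auto
  have stepu: "dist (u n) (u (Suc n)) \<le> (l * r 0) * (1 / 2) ^ n" for n
  proof -
    have "dist (u n) (u (Suc n)) = \<mu> n * r n"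
      using \<mu>[of n] by (simp add: u dist_norm r_def norm_minus_commute)
    also have "\<dots> \<le> \<mu> n * r 0"
      using \<mu>[of n] r_decr by (intro mult_left_mono) auto
    finally show ?thesis by (simp add: \<mu>_def mult_ac)
  qed
  have stepb: "dist (b n) (b (Suc n)) \<le> 1 * (1 / 2) ^ n" for n
  proof -
    have "infdist (u n) \<Omega> \<le> norm (u n - b (Suc n))"
      using infdist_le[OF b] by (simp add: dist_norm)
    then have 1: "(infdist (u n) \<Omega>)\<^sup>2 \<le> (norm (u n - b (Suc n)))\<^sup>2"
      by (intro power_mono infdist_nonneg)
    have "(r n)\<^sup>2 - e n \<le> (norm (u n - b (Suc n)))\<^sup>2" using 1 r[of n] by linarith
    then have 2: "(1 - \<mu> n) * ((r n)\<^sup>2 - e n) \<le> (1 - \<mu> n) * (norm (u n - b (Suc n)))\<^sup>2"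
      using \<mu>[of n] by (intro mult_left_mono) auto
    have "(r (Suc n))\<^sup>2 \<le> ((1 - \<mu> n) * r n)\<^sup>2"
      using rb[of n] r_nonneg by (intro power_mono) (simp_all add: ub)
    then have "\<mu> n * (norm (b n - b (Suc n)))\<^sup>2
        \<le> ((1 - \<mu> n) * r n)\<^sup>2 - (1 - \<mu> n) * ((r n)\<^sup>2 - e n) + \<mu> n * (1 - \<mu> n) * (r n)\<^sup>2"
      using 2 stewart_identity[of "\<mu> n" "b n" "b (Suc n)" "u n"]
      by (simp add: u[symmetric] r_def[symmetric])
    \<comment> \<open>The three terms in \<open>(r n)\<^sup>2\<close> share the factor
      \<open>1 - \<mu> n\<close>, and their other factors \<open>1 - \<mu> n\<close>,
      \<open>- 1\<close> and \<open>\<mu> n\<close> add up to zero.\<close>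
    also have "\<dots> = (1 - \<mu> n) * e n"
      by (simp add: algebra_simps power2_eq_square)
    also have "\<dots> \<le> 1 * e n"
      using \<mu>[of n] e[of n] by (intro mult_right_mono) auto
    also have "\<dots> = \<mu> n * ((1 / 2) ^ n)\<^sup>2"
      by (simp add: e_def \<mu>_def power2_eq_square flip: power_mult_distrib)
    finally have "(norm (b n - b (Suc n)))\<^sup>2 \<le> ((1 / 2) ^ n)\<^sup>2"
      using \<mu>[of n] by (simp only: mult_le_cancel_left_pos)
    then have "norm (b n - b (Suc n)) \<le> (1 / 2) ^ n" by (rule power2_le_imp_le) simp
    then show ?thesis by (simp add: dist_norm)
  qed
  obtain z where z: "u \<longlonglongrightarrow> z" "\<And>n. dist (u n) z \<le> l * r 0 * (1 / 2) ^ n / (1 - 1 / 2)"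
    by (rule geometric_steps_convergent[OF _ _ _ stepu]) (use l r_nonneg in auto)
  obtain p where p: "b \<longlonglongrightarrow> p"
    by (rule geometric_steps_convergent[OF _ _ _ stepb]) auto
  have "p \<in> \<Omega>" using assms(1) b p closed_sequentially by blast
  \<comment> \<open>The tolerances vanish in the limit, so \<open>p\<close> becomes an exact nearest
    point of \<open>z\<close>.\<close>
  have "e \<longlonglongrightarrow> l * 0"
    unfolding e_def by (intro tendsto_intros LIMSEQ_power_zero) auto
  then have "(\<lambda>n. (infdist (u n) \<Omega>)\<^sup>2 + e n) \<longlonglongrightarrow> (infdist z \<Omega>)\<^sup>2 + l * 0"
    by (intro tendsto_intros tendsto_infdist z)
  moreover have "(\<lambda>n. (r n)\<^sup>2) \<longlonglongrightarrow> (norm (z - p))\<^sup>2"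
    unfolding r_def by (intro tendsto_intros z p)
  ultimately have "(norm (z - p))\<^sup>2 \<le> (infdist z \<Omega>)\<^sup>2 + l * 0"
    using r by (intro LIMSEQ_le) auto
  then have "dist z p \<le> infdist z \<Omega>"
    unfolding dist_norm by (intro power2_le_imp_le[OF _ infdist_nonneg]) simp
  with \<open>p \<in> \<Omega>\<close> have "p \<in> projection \<Omega> z"
    by (simp add: projection_def infdist_le antisym)
  moreover have "l * r 0 \<le> l * (d + 1)" using l r0 by (intro mult_left_mono) auto
  then have "dist y z \<le> \<epsilon>"
    using z(2)[of 0] l(3) by (simp add: u0 algebra_simps)
  ultimately show thesis by (rule that[rotated])
qed

section \<open>Growth of the distance function under translation\<close>

lemma projection_near:
  assumes "xbar \<in> \<Omega>" "p \<in> projection \<Omega> z"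
  shows "dist p xbar \<le> 2 * dist z xbar"
  using assms infdist_le[OF assms(1), of z] dist_triangle3[of p xbar z]
  by (auto simp: projection_def)

text \<open>At a point with a nearest point \<open>p\<close>, this expands the squared distance from
  the translated point to \<open>p\<close>. A general \<open>y\<close> need not have one, so the
  bound is proved at nearby points that do and passed to the limit. The radius
  \<open>\<delta> / 2\<close> makes their projections fall in the ball where \<open>normals\<close>
  applies.\<close>

lemma infdist_translate_square_le:
  fixes \<Omega> :: "'a::{real_inner,complete_space} set"
  assumes "closed \<Omega>" "xbar \<in> \<Omega>" "0 \<le> h"
    and normals: "\<And>a p. p \<in> projection \<Omega> a \<Longrightarrow> p \<in> cball xbar \<delta> \<Longrightarrow>
      inner w (a - p) \<le> \<kappa> * norm w * norm (a - p)"
    and y: "y \<in> ball xbar (\<delta> / 2)"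
  shows "(infdist (y + h *\<^sub>R w) \<Omega>)\<^sup>2
    \<le> (infdist y \<Omega>)\<^sup>2 + 2 * h * \<kappa> * norm w * infdist y \<Omega> + h\<^sup>2 * (norm w)\<^sup>2"
proof -
  have "\<exists>z. dist y z \<le> 1 / real (Suc n) \<and> projection \<Omega> z \<noteq> {}" for n
  proof -
    have "\<Omega> \<noteq> {}" "1 / real (Suc n) > 0" using assms(2) by auto
    then obtain z p where "dist y z \<le> 1 / real (Suc n)" "p \<in> projection \<Omega> z"
      by (rule exists_projection_near[OF assms(1)])
    then show ?thesis by blast
  qed
  then obtain z where z: "\<And>n. dist y (z n) \<le> 1 / real (Suc n)" "\<And>n. projection \<Omega> (z n) \<noteq> {}"
    by metis
  have "dist (z n) y \<le> inverse (real (Suc n))" for n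
    using z(1)[of n] by (metis dist_commute inverse_eq_divide)
  then have "(\<lambda>n. dist (z n) y) \<longlonglongrightarrow> 0"
    using tendsto_sandwich[of "\<lambda>_. 0" "\<lambda>n. dist (z n) y" sequentially "\<lambda>n. inverse (real (Suc n))" 0]
    by (simp add: LIMSEQ_inverse_real_of_nat del: of_nat_Suc)
  then have lim: "z \<longlonglongrightarrow> y" by (rule tendsto_dist_iff[THEN iffD2])
  have *: "(infdist (z n + h *\<^sub>R w) \<Omega>)\<^sup>2
      \<le> (infdist (z n) \<Omega>)\<^sup>2 + 2 * h * \<kappa> * norm w * infdist (z n) \<Omega> + h\<^sup>2 * (norm w)\<^sup>2"
    if "z n \<in> ball xbar (\<delta> / 2)" for n
  proof -
    obtain p where p: "p \<in> projection \<Omega> (z n)" using z(2) by blast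
    have "p \<in> cball xbar \<delta>"
      using projection_near[OF assms(2) p] that by (simp add: dist_commute)
    from normals[OF p this]
    have 1: "h * inner w (z n - p) \<le> h * (\<kappa> * norm w * norm (z n - p))"
      using assms(3) by (intro mult_left_mono)
    have 2: "norm (z n - p) = infdist (z n) \<Omega>" "p \<in> \<Omega>"
      using p by (auto simp: projection_def dist_norm)
    have "infdist (z n + h *\<^sub>R w) \<Omega> \<le> norm (z n + h *\<^sub>R w - p)"
      using infdist_le[OF 2(2)] by (simp add: dist_norm)
    then have "(infdist (z n + h *\<^sub>R w) \<Omega>)\<^sup>2 \<le> (norm (z n + h *\<^sub>R w - p))\<^sup>2"
      by (intro power_mono infdist_nonneg)
    also have "\<dots> = (norm (z n - p))\<^sup>2 + 2 * (h * inner w (z n - p)) + h\<^sup>2 * (norm w)\<^sup>2"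
      unfolding power2_norm_eq_inner
      by (simp add: inner_simps inner_commute algebra_simps power2_eq_square)
    also have "\<dots> \<le> (norm (z n - p))\<^sup>2 + 2 * (h * (\<kappa> * norm w * norm (z n - p))) + h\<^sup>2 * (norm w)\<^sup>2"
      using 1 by linarith
    finally show ?thesis by (simp add: 2(1) mult_ac)
  qed
  have ev: "\<forall>\<^sub>F n in sequentially. z n \<in> ball xbar (\<delta> / 2)"
    using topological_tendstoD[OF lim open_ball y] .
  show ?thesis
  proof (rule tendsto_le[OF sequentially_bot])
    show "(\<lambda>n. (infdist (z n) \<Omega>)\<^sup>2 + 2 * h * \<kappa> * norm w * infdist (z n) \<Omega> + h\<^sup>2 * (norm w)\<^sup>2)
      \<longlonglongrightarrow> (infdist y \<Omega>)\<^sup>2 + 2 * h * \<kappa> * norm w * infdist y \<Omega> + h\<^sup>2 * (norm w)\<^sup>2"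
      by (intro tendsto_intros tendsto_infdist lim)
    show "(\<lambda>n. (infdist (z n + h *\<^sub>R w) \<Omega>)\<^sup>2) \<longlonglongrightarrow> (infdist (y + h *\<^sub>R w) \<Omega>)\<^sup>2"
      by (intro tendsto_intros tendsto_infdist lim)
    show "\<forall>\<^sub>F n in sequentially. (infdist (z n + h *\<^sub>R w) \<Omega>)\<^sup>2
      \<le> (infdist (z n) \<Omega>)\<^sup>2 + 2 * h * \<kappa> * norm w * infdist (z n) \<Omega> + h\<^sup>2 * (norm w)\<^sup>2"
      using ev by eventually_elim (rule *)
  qed
qed

text \<open>Euler's method with \<open>N\<close> steps; the slack \<open>s\<close> keeps the bound \<open>F\<close> away from zero, so that it
  absorbs the quadratic error.\<close>

lemma infdist_translate_le:
  fixes \<Omega> :: "'a::{real_inner,complete_space} set"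
  assumes "closed \<Omega>" "xbar \<in> \<Omega>" "0 \<le> \<kappa>"
    and normals: "\<And>a p. p \<in> projection \<Omega> a \<Longrightarrow> p \<in> cball xbar \<delta> \<Longrightarrow>
      inner w (a - p) \<le> \<kappa> * norm w * norm (a - p)"
    and ends: "u \<in> ball xbar (\<delta> / 2)" "u + w \<in> ball xbar (\<delta> / 2)"
  shows "infdist (u + w) \<Omega> \<le> infdist u \<Omega> + \<kappa> * norm w"
proof (rule field_le_epsilon)
  fix \<epsilon> :: real assume "\<epsilon> > 0"
  \<comment> \<open>Half of \<open>\<epsilon>\<close> is the initial slack; the other half is the
    extra slope accumulated over unit time.\<close>
  define s where "s = \<epsilon> / 2"
  have s: "s > 0" using \<open>\<epsilon> > 0\<close> by (simp add: s_def)
  \<comment> \<open>\<open>N\<close> is chosen for the bound \<open>hs\<close>: since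
    \<open>s \<le> F j\<close>, the quadratic error of a step is then at most
    \<open>2 * h * s * F j\<close>.\<close>
  obtain N :: nat where N: "(norm w)\<^sup>2 / (2 * s\<^sup>2) < real N" "N > 0"
    by (metis reals_Archimedean2 less_trans of_nat_0_less_iff gr0I of_nat_0)
  define h where "h = 1 / real N"
  have h: "h > 0" using N(2) by (simp add: h_def)
  have hs: "h * (norm w)\<^sup>2 \<le> 2 * s\<^sup>2"
    using N s by (simp add: h_def field_simps)
  define F where "F j = infdist u \<Omega> + s + (\<kappa> * norm w + s) * (real j * h)" for j
  have "infdist (u + (real j * h) *\<^sub>R w) \<Omega> \<le> F j" if "j \<le> N" for j
    using that
  proof (induction j)
    case 0
    then show ?case using s by (simp add: F_def)
  next
    case (Suc j)
    let ?y = "u + (real j * h) *\<^sub>R w"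
    have "real j * h \<le> 1" using Suc.prems N(2) by (simp add: h_def)
    then have "(1 - real j * h) *\<^sub>R u + (real j * h) *\<^sub>R (u + w) \<in> ball xbar (\<delta> / 2)"
      using h by (intro convexD[OF convex_ball ends]) auto
    then have y: "?y \<in> ball xbar (\<delta> / 2)" by (simp add: algebra_simps)
    have IH: "infdist ?y \<Omega> \<le> F j" using Suc by simp
    have Fs: "s \<le> F j" using s assms(3) h by (simp add: F_def infdist_nonneg)
    have "(infdist (?y + h *\<^sub>R w) \<Omega>)\<^sup>2
        \<le> (infdist ?y \<Omega>)\<^sup>2 + 2 * h * \<kappa> * norm w * infdist ?y \<Omega> + h\<^sup>2 * (norm w)\<^sup>2"
      using infdist_translate_square_le[OF assms(1,2) _ normals y] h by simp
    also have "\<dots> \<le> (F j)\<^sup>2 + 2 * h * \<kappa> * norm w * F j + h * (2 * s * F j)"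
    proof -
      have "h\<^sup>2 * (norm w)\<^sup>2 = h * (h * (norm w)\<^sup>2)" by (simp add: power2_eq_square)
      also have "\<dots> \<le> h * (2 * s\<^sup>2)" using h hs by (intro mult_left_mono) auto
      also have "\<dots> \<le> h * (2 * s * F j)" using h s Fs by (simp add: power2_eq_square)
      finally show ?thesis
        using IH h assms(3) by (intro add_mono power_mono mult_left_mono infdist_nonneg) auto
    qed
    \<comment> \<open>Expanding the right side reproduces the left side plus one further
      square.\<close>
    also have "\<dots> \<le> (F j + (\<kappa> * norm w + s) * h)\<^sup>2"
      using zero_le_power2[of "(\<kappa> * norm w + s) * h"]
      by (simp add: power2_eq_square algebra_simps)
    also have "F j + (\<kappa> * norm w + s) * h = F (Suc j)"
      by (simp add: F_def algebra_simps)
    finally have "infdist (?y + h *\<^sub>R w) \<Omega> \<le> F (Suc j)"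
      using s h assms(3) by (rule_tac power2_le_imp_le) (auto simp: F_def infdist_nonneg)
    then show ?case by (simp add: algebra_simps)
  qed
  from this[of N] show "infdist (u + w) \<Omega> \<le> infdist u \<Omega> + \<kappa> * norm w + \<epsilon>"
    using N(2) by (simp add: F_def h_def s_def)
qed

section \<open>Normals from projections and the angle bound\<close>

text \<open>Expanding \<open>norm (x - y) \<le> norm (x - z)\<close> bounds
  \<open>inner (x - y) (z - y)\<close> by half the square of \<open>norm (z - y)\<close>, so the
  quotient is at most linear in \<open>norm (z - y)\<close>. The value \<open>t = 0\<close> serves
  to supply the zero normal.\<close>

lemma projection_frechet_normal:
  assumes "y \<in> projection \<Omega> x" "0 \<le> t"
  shows "t *\<^sub>R (x - y) \<in> frechet_normal_cone \<Omega> y"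
proof -
  let ?f = "\<lambda>z. ereal (inner (t *\<^sub>R (x - y)) (z - y) / norm (z - y))"
  have le: "?f z \<le> ereal (t * norm (z - y) / 2)" if "z \<in> \<Omega>" for z
  proof (cases "z = y")
    case False
    have "norm (x - y) \<le> norm (x - z)"
      using assms infdist_le[OF that, of x] by (auto simp: projection_def dist_norm)
    then have "(norm (x - y))\<^sup>2 \<le> (norm (x - z))\<^sup>2" by (intro power_mono) auto
    then have "inner (x - y) (z - y) \<le> (norm (z - y))\<^sup>2 / 2"
      unfolding power2_norm_eq_inner by (simp add: inner_simps inner_commute)
    then have "t * inner (x - y) (z - y) \<le> t * ((norm (z - y))\<^sup>2 / 2)"
      using assms(2) by (intro mult_left_mono)
    then have "inner (t *\<^sub>R (x - y)) (z - y) \<le> t * norm (z - y) / 2 * norm (z - y)"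
      by (simp add: power2_eq_square)
    moreover have "norm (z - y) > 0" using False by simp
    ultimately show ?thesis by (simp only: pos_divide_le_eq ereal_less_eq)
  qed simp
  show ?thesis
  proof (cases "at y within \<Omega> = bot")
    \<comment> \<open>For isolated \<open>y\<close> the upper limit along the trivial filter is
      \<open>-\<infinity>\<close>.\<close>
    case True
    then show ?thesis by (simp add: frechet_normal_cone_def)
  next
    case False
    have "((\<lambda>z. t * norm (z - y) / 2) \<longlongrightarrow> t * norm (y - y) / 2) (at y within \<Omega>)"
      by (intro tendsto_intros) auto
    then have "Limsup (at y within \<Omega>) (\<lambda>z. ereal (t * norm (z - y) / 2)) = 0"
      using False by (intro lim_imp_Limsup) (auto simp: zero_ereal_def)
    moreover have "Limsup (at y within \<Omega>) ?f \<le> Limsup (at y within \<Omega>) (\<lambda>z. ereal (t * norm (z - y) / 2))"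
      by (intro Limsup_mono) (use le in \<open>auto simp: eventually_at_filter\<close>)
    ultimately show ?thesis by (simp add: frechet_normal_cone_def)
  qed
qed

lemma eta_hat_at_le:
  assumes "\<And>i. i \<in> {1..m} \<Longrightarrow> x' i \<in> frechet_normals_near (\<Omega> i) xbar \<delta>"
    and "(\<Sum>i=1..m. norm (x' i)) = 1"
  shows "eta_hat_at m \<Omega> xbar \<delta> \<le> norm (\<Sum>i=1..m. x' i)"
proof -
  have "norm (\<Sum>i=1..m. x' i) \<in> normal_sum_norms m \<Omega> xbar \<delta>"
    using assms by (auto simp: normal_sum_norms_def)
  moreover have "bdd_below (normal_sum_norms m \<Omega> xbar \<delta>)"
    by (meson bdd_belowI normal_sum_norms_bounds(1))
  ultimately show ?thesis
    by (auto simp: eta_hat_at_def intro: cInf_lower)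
qed

text \<open>Residuals scaled to norm 1/2, \<open>U\<close> and \<open>V\<close>, satisfy
  \<open>(norm (U + V))\<^sup>2 = 1 / 2 + 2 * inner U V\<close>, and \<open>4 * inner U V\<close> is
  the cosine of their angle. Comparison with the infimum bounds minus the cosine by the expression
  that tends to \<open>c_hat\<close>.\<close>

lemma inner_projection_residuals_ge:
  fixes \<Omega> :: "nat \<Rightarrow> 'a::real_inner set"
  assumes "0 < \<delta>" "xbar \<in> (\<Inter>i\<in>{1..m}. \<Omega> i)"
    and eta: "1 - 2 * (eta_hat_at m \<Omega> xbar \<delta>)\<^sup>2 \<le> \<kappa>"
    and ij: "i \<in> {1..m}" "j \<in> {1..m}" "i \<noteq> j"
    and p: "p \<in> projection (\<Omega> i) a" "p \<in> cball xbar \<delta>"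
    and q: "q \<in> projection (\<Omega> j) b" "q \<in> cball xbar \<delta>"
  shows "- inner (a - p) (b - q) \<le> \<kappa> * norm (a - p) * norm (b - q)"
proof (cases "a = p \<or> b = q")
  case True
  then show ?thesis by auto
next
  case False
  define \<alpha> \<beta> where "\<alpha> = norm (a - p)" and "\<beta> = norm (b - q)"
  have pos: "\<alpha> > 0" "\<beta> > 0" using False by (auto simp: \<alpha>_def \<beta>_def)
  define U V where "U = (1 / (2 * \<alpha>)) *\<^sub>R (a - p)" and "V = (1 / (2 * \<beta>)) *\<^sub>R (b - q)"
  have norms: "norm U = 1 / 2" "norm V = 1 / 2"
    using pos by (auto simp: U_def V_def \<alpha>_def \<beta>_def)
  define x' where "x' l = (if l = i then U else 0) + (if l = j then V else 0)" for l
  have "x' l \<in> frechet_normals_near (\<Omega> l) xbar \<delta>" if "l \<in> {1..m}" for l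
  proof -
    have "U \<in> frechet_normal_cone (\<Omega> i) p" "V \<in> frechet_normal_cone (\<Omega> j) q"
      unfolding U_def V_def using p q pos by (auto intro!: projection_frechet_normal)
    then have UV: "U \<in> frechet_normals_near (\<Omega> i) xbar \<delta>" "V \<in> frechet_normals_near (\<Omega> j) xbar \<delta>"
      unfolding frechet_normals_near_def using p q by (auto simp: projection_def)
    have "xbar \<in> \<Omega> l" using assms(2) that by blast
    \<comment> \<open>All other positions must carry a normal too: \<open>xbar\<close> projects to
      itself, which gives the zero normal.\<close>
    then have "xbar \<in> projection (\<Omega> l) xbar" by (simp add: projection_def)
    from projection_frechet_normal[OF this, of 0]
    have "0 \<in> frechet_normals_near (\<Omega> l) xbar \<delta>"
      using \<open>xbar \<in> \<Omega> l\<close> assms(1) unfolding frechet_normals_near_def by force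
    with UV ij(3) show ?thesis by (auto simp: x'_def)
  qed
  moreover have "(\<Sum>l=1..m. norm (x' l)) = (\<Sum>l=1..m. (if l = i then 1/2 else 0) + (if l = j then 1/2 else 0))"
    using ij(3) norms by (intro sum.cong) (auto simp: x'_def)
  then have "(\<Sum>l=1..m. norm (x' l)) = 1"
    using ij by (simp add: sum.distrib)
  moreover have "(\<Sum>l=1..m. x' l) = U + V"
    using ij by (simp add: x'_def sum.distrib)
  ultimately have "eta_hat_at m \<Omega> xbar \<delta> \<le> norm (U + V)"
    using eta_hat_at_le[of m x' \<Omega> xbar \<delta>] by simp
  then have "(eta_hat_at m \<Omega> xbar \<delta>)\<^sup>2 \<le> (norm (U + V))\<^sup>2"
    by (intro power_mono eta_hat_at_bounds)
  also have "\<dots> = (norm U)\<^sup>2 + (norm V)\<^sup>2 + 2 * inner U V"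
    unfolding power2_norm_eq_inner by (simp add: inner_simps inner_commute)
  finally have "- (4 * inner U V) \<le> \<kappa>"
    using eta by (simp add: norms power2_eq_square)
  moreover have "4 * inner U V = inner (a - p) (b - q) / (\<alpha> * \<beta>)"
    by (simp add: U_def V_def)
  ultimately have "- inner (a - p) (b - q) / (\<alpha> * \<beta>) \<le> \<kappa>"
    by simp
  then have "- inner (a - p) (b - q) \<le> \<kappa> * (\<alpha> * \<beta>)"
    using pos by (simp only: pos_divide_le_eq mult_pos_pos)
  then show ?thesis by (simp add: \<alpha>_def \<beta>_def mult_ac)
qed

section \<open>Linear convergence of the cyclic projections\<close>

theorem theorem3:
  fixes \<Omega> :: "nat \<Rightarrow> 'a::{real_inner,complete_space} set"
    and m :: nat and xbar :: 'a and c :: real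
  assumes "m > 1"
    and "\<forall>i\<in>{1..m}. closed (\<Omega> i)"
    and "xbar \<in> (\<Inter>i\<in>{1..m}. \<Omega> i)"
    and "uniformly_regular m \<Omega> xbar"
    and "c_hat m \<Omega> xbar < 1 / (real m - 1)"
    and "super_regular (\<Omega> 1) xbar"
    and "c \<in> {(real m - 1) * c_hat m \<Omega> xbar <..< 1}"
    and "c > 0"
  shows "\<exists>r>0. \<forall>x :: nat \<Rightarrow> 'a.
           cyclic_projections m \<Omega> x \<and> norm (x 0 - xbar) < r \<and>
           (\<forall>k. \<forall>i\<in>{2..m}.
              norm (x (k * m + i + 1) - x (k * m + i)) \<le> norm (x (k * m + 2) - x (k * m + 1))) \<longrightarrow>
           (\<exists>xtilde \<in> (\<Inter>i\<in>{1..m}. \<Omega> i). linearly_converges x xtilde (root m c))"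
proof -
  \<comment> \<open>By the choice of \<open>c\<close>, \<open>\<kappa>\<close> lies strictly above
    \<open>c_hat\<close>; this gap lets one positive \<open>\<delta>\<close> replace the limit in
    \<open>eta_hat\<close>.\<close>
  define \<kappa> where "\<kappa> = c / (real m - 1)"
  define q where "q = root m c"
  have m: "real m - 1 > 0" using assms(1) by simp
  have \<kappa>: "\<kappa> > 0" "c_hat m \<Omega> xbar < \<kappa>" "(real m - 1) * \<kappa> = c"
    using assms(7,8) m by (auto simp: \<kappa>_def field_simps)
  have c: "0 < c" "c < 1" using assms(7,8) by auto
  have q: "0 < q" "q < 1" "q ^ m = c"
    using assms(1) c by (auto simp: q_def real_root_lt_1_iff)
  have "((\<lambda>\<delta>. 1 - 2 * (eta_hat_at m \<Omega> xbar \<delta>)\<^sup>2) \<longlongrightarrow> c_hat m \<Omega> xbar) (at_right 0)"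
    unfolding c_hat_def by (intro tendsto_intros eta_hat_tendsto)
  from order_tendstoD(2)[OF this \<kappa>(2)]
  obtain b where "b > 0" and b: "\<And>\<delta>. 0 < \<delta> \<Longrightarrow> \<delta> < b \<Longrightarrow> 1 - 2 * (eta_hat_at m \<Omega> xbar \<delta>)\<^sup>2 < \<kappa>"
    by (auto simp: eventually_at_right_field)
  define \<delta> where "\<delta> = b / 2"
  have \<delta>: "\<delta> > 0" "1 - 2 * (eta_hat_at m \<Omega> xbar \<delta>)\<^sup>2 \<le> \<kappa>"
    using \<open>b > 0\<close> b[of \<delta>] by (simp_all add: \<delta>_def)
  \<comment> \<open>\<open>K * r\<close> bounds the distance to \<open>xbar\<close>:
    \<open>2 * r\<close> for \<open>x 1\<close>, the rest for the travel after it. That travel is at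
    most \<open>2 * r / (c * (1 - q))\<close>; the 3 makes the inequality strict, as the open ball
    requires.\<close>
  define K where "K = 2 + 3 / (c * (1 - q))"
  have K: "K > 0" using c q by (simp add: K_def add_pos_pos)
  define r where "r = \<delta> / (2 * K)"
  have r: "r > 0" "K * r = \<delta> / 2" using \<delta>(1) K by (simp_all add: r_def)
  have "\<exists>xtilde \<in> (\<Inter>i\<in>{1..m}. \<Omega> i). linearly_converges x xtilde (root m c)"
    if cyc: "cyclic_projections m \<Omega> x" and x0: "norm (x 0 - xbar) < r"
      and steps: "\<And>k i. i \<in> {2..m} \<Longrightarrow>
        norm (x (k * m + i + 1) - x (k * m + i)) \<le> norm (x (k * m + 2) - x (k * m + 1))"
    for x :: "nat \<Rightarrow> 'a"
  proof -
    have xbar: "xbar \<in> \<Omega> i" if "i \<in> {1..m}" for i using assms(3) that by blast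
    have idx: "k mod m + 1 \<in> {1..m}" for k
      using assms(1) mod_less_divisor[of m k] by (auto simp: Suc_le_eq)
    have proj: "x (Suc k) \<in> projection (\<Omega> (k mod m + 1)) (x k)" for k
      using cyc by (simp add: cyclic_projections_def)
    have proj2: "x (k * m + 2) \<in> projection (\<Omega> 2) (x (k * m + 1))" for k
    proof -
      have "(k * m + 1) mod m = 1"
        using assms(1) by (metis mod_mult_self3 mod_less)
      with proj[of "k * m + 1"] show ?thesis by (simp add: numeral_2_eq_2)
    qed
    \<comment> \<open>As \<open>x (k * m + i)\<close> lies in \<open>\<Omega> i\<close>,
      \<open>D k\<close> is the step from \<open>\<Omega> 1\<close> to \<open>\<Omega> 2\<close> in
      cycle \<open>k\<close>, hence the distance from \<open>x (k * m + 1)\<close> to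
      \<open>\<Omega> 2\<close>.\<close>
    define D where "D k = dist (x (k * m + 1)) (x (k * m + 2))" for k
    have step_le: "dist (x (k * m + i)) (x (k * m + i + 1)) \<le> D k" if "i \<in> {1..m}" for k i
    proof (cases "i = 1")
      case False
      with that steps[of i k] show ?thesis by (simp add: D_def dist_norm norm_minus_commute)
    qed (simp add: D_def)
    have x1: "dist (x 1) xbar \<le> 2 * r"
      using projection_near[OF xbar[OF idx] proj, of 0] x0 by (simp add: dist_norm)
    have D0: "D 0 \<le> 2 * r"
    proof -
      have "x 2 \<in> projection (\<Omega> 2) (x 1)" using proj2[of 0] by (simp add: numeral_2_eq_2)
      moreover have "xbar \<in> \<Omega> 2" using xbar[of 2] assms(1) by simp
      ultimately have "dist (x 1) (x 2) \<le> dist (x 1) xbar"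
        by (simp add: projection_def infdist_le)
      with x1 show ?thesis by (simp add: D_def numeral_2_eq_2)
    qed
    \<comment> \<open>Step \<open>n\<close> of cycle \<open>k\<close> has
      \<open>n \<le> m + m * k\<close>, so \<open>c ^ k \<le> q ^ n / c\<close>: contraction comes
      only once per cycle, which costs a factor \<open>1 / c\<close>.\<close>
    define C where "C = 2 * r / c"
    have C: "C > 0" using r c by (simp add: C_def)
    \<comment> \<open>Only the cycle containing step \<open>n\<close> is assumed to contract, so
      this is usable inside the induction for \<open>D_le\<close>. The shift by 1 reflects that
      cycles start at index \<open>k * m + 1\<close>.\<close>
    have step_q: "dist (x n) (x (Suc n)) \<le> C * q ^ n"
      if "1 \<le> n" "D ((n - 1) div m) \<le> c ^ ((n - 1) div m) * D 0" for n
    proof -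
      define k where "k = (n - 1) div m"
      define i where "i = (n - 1) mod m + 1"
      have "n = k * m + i" using that(1) div_mult_mod_eq[of "n - 1" m] by (simp add: k_def i_def)
      moreover have "i \<in> {1..m}" using idx by (simp add: i_def)
      ultimately have n: "n = k * m + i" "n \<le> m + m * k" "i \<in> {1..m}"
        by (auto simp: mult.commute)
      have "dist (x n) (x (Suc n)) \<le> D k" using step_le[OF n(3), of k] n(1) by simp
      also have "\<dots> \<le> c ^ k * D 0" using that(2) by (simp add: k_def)
      also have "\<dots> \<le> c ^ k * (2 * r)" using D0 c by (intro mult_left_mono) auto
      also have "\<dots> = C * q ^ (m + m * k)"
        using c by (simp add: C_def power_add power_mult q(3))
      also have "\<dots> \<le> C * q ^ n"
        using n(2) q C by (intro mult_left_mono power_decreasing) auto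
      finally show ?thesis .
    qed
    \<comment> \<open>Strong induction: the angle bound needs iterates near \<open>xbar\<close>, and
      their nearness rests on the contraction of all earlier cycles.\<close>
    have D_le: "D k \<le> c ^ k * D 0" for k
    proof (induction k rule: less_induct)
      case (less k)
      show ?case
      proof (cases k)
        case (Suc l)
        \<comment> \<open>All steps from \<open>x 1\<close> up to \<open>x (l * m + m + 1)\<close>
          belong to cycles \<open>0\<close> to \<open>l\<close>, which the induction hypothesis
          covers.\<close>
        have near: "x n \<in> ball xbar (\<delta> / 2)" if "1 \<le> n" "n \<le> l * m + m + 1" for n
        proof -
          have "dist (x 1) (x n) \<le> C * q ^ 1 / (1 - q)"
          proof (rule dist_le_of_geometric_steps)
            fix i assume i: "1 \<le> i" "i < n"
            then have "(i - 1) div m < k"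
              using that(2) assms(1) Suc by (intro div_less_iff_less_mult[THEN iffD2]) auto
            then show "dist (x i) (x (Suc i)) \<le> C * q ^ i"
              using less i by (intro step_q) auto
          qed (use C q that in auto)
          also have "\<dots> \<le> C / (1 - q)" using C q by (intro divide_right_mono) auto
          also have "\<dots> < 3 * r / (c * (1 - q))"
            using r c q by (simp add: C_def field_simps)
          finally have "dist (x 1) (x n) < 3 * r / (c * (1 - q))" .
          then have "dist (x n) xbar < 2 * r + 3 * r / (c * (1 - q))"
            using x1 dist_triangle3[of "x n" xbar "x 1"] by linarith
          also have "\<dots> = K * r" by (simp add: K_def algebra_simps)
          finally show ?thesis by (simp add: r(2) dist_commute)
        qed
        have "infdist (x (l * m + 2 + j)) (\<Omega> 2) \<le> real j * (\<kappa> * D l)" if "j \<le> m - 1" for j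
          using that
        proof (induction j)
          case 0
          have "x (l * m + 2) \<in> \<Omega> 2" using proj2 by (simp add: projection_def)
          then show ?case by simp
        next
          case (Suc j)
          let ?n = "l * m + 2 + j"
          let ?i = "?n mod m + 1"
          \<comment> \<open>These steps project onto \<open>\<Omega> 3\<close>, ...,
            \<open>\<Omega> m\<close> and finally \<open>\<Omega> 1\<close>; the angle bound needs
            an index different from 2.\<close>
          have i: "?i \<noteq> 2"
          proof -
            have "?n mod m = (2 + j) mod m" by (metis add.assoc mod_mult_self3)
            also have "\<dots> \<noteq> 1"
              using Suc.prems assms(1) by (cases "2 + j = m") auto
            finally show ?thesis by simp
          qed
          have "1 \<le> ?n" "Suc ?n \<le> l * m + m + 1"
            using Suc.prems assms(1) by linarith+
          then have near': "x ?n \<in> ball xbar (\<delta> / 2)" "x (Suc ?n) \<in> ball xbar (\<delta> / 2)"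
            using near[of ?n] near[of "Suc ?n"] by simp_all
          have "infdist (x ?n + (x (Suc ?n) - x ?n)) (\<Omega> 2)
              \<le> infdist (x ?n) (\<Omega> 2) + \<kappa> * norm (x (Suc ?n) - x ?n)"
          proof (rule infdist_translate_le)
            fix a p assume "p \<in> projection (\<Omega> 2) a" "p \<in> cball xbar \<delta>"
            moreover have "x (Suc ?n) \<in> cball xbar \<delta>" using near'(2) \<delta>(1) by auto
            \<comment> \<open>The residual of the step, a normal at its endpoint, is minus the
              displacement; hence the sign.\<close>
            ultimately have "- inner (x ?n - x (Suc ?n)) (a - p)
                \<le> \<kappa> * norm (x ?n - x (Suc ?n)) * norm (a - p)"
              using assms(1,3) i idx \<delta> proj
              by (intro inner_projection_residuals_ge[where i = ?i and j = 2]) auto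
            then show "inner (x (Suc ?n) - x ?n) (a - p) \<le> \<kappa> * norm (x (Suc ?n) - x ?n) * norm (a - p)"
              by (simp add: inner_diff_left norm_minus_commute)
          qed (use assms(1,2) xbar \<kappa> near' in auto)
          also have "\<dots> \<le> real j * (\<kappa> * D l) + \<kappa> * D l"
          proof (intro add_mono mult_left_mono)
            show "norm (x (Suc ?n) - x ?n) \<le> D l"
              using step_le[of "2 + j" l] Suc.prems assms(1)
              by (simp add: dist_norm norm_minus_commute add.assoc)
          qed (use Suc \<kappa> in auto)
          finally show ?case by (simp add: algebra_simps)
        qed
        from this[of "m - 1"]
        have "infdist (x (l * m + m + 1)) (\<Omega> 2) \<le> real (m - 1) * (\<kappa> * D l)"
          using assms(1) by (simp add: numeral_2_eq_2)
        also have "\<dots> = c * D l"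
          using assms(1) \<kappa>(3) by (simp add: of_nat_diff flip: mult.assoc)
        also have "\<dots> \<le> c * (c ^ l * D 0)"
          using less Suc c by (intro mult_left_mono) auto
        also have "infdist (x (l * m + m + 1)) (\<Omega> 2) = D k"
          using proj2[of k] by (simp add: projection_def D_def Suc add_ac)
        finally show ?thesis by (simp add: Suc)
      qed simp
    qed
    \<comment> \<open>The step from the arbitrary point \<open>x 0\<close> precedes the first cycle,
      so its length enters the constant directly.\<close>
    define C' where "C' = max C (dist (x 0) (x 1))"
    have C': "C' \<ge> 0" using C by (simp add: C'_def)
    have "dist (x n) (x (Suc n)) \<le> C' * q ^ n" for n
    proof (cases "n = 0")
      case False
      then have "dist (x n) (x (Suc n)) \<le> C * q ^ n" using D_le by (intro step_q) auto
      also have "\<dots> \<le> C' * q ^ n" using q by (intro mult_right_mono) (auto simp: C'_def)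
      finally show ?thesis .
    qed (simp add: C'_def)
    then obtain l where l: "x \<longlonglongrightarrow> l" "\<And>n. dist (x n) l \<le> C' * q ^ n / (1 - q)"
      using geometric_steps_convergent[of C' q x] C' q by (metis less_imp_le)
    \<comment> \<open>The iterates visit the closed set \<open>\<Omega> i\<close> once per cycle,
      and this subsequence has the same limit.\<close>
    have "l \<in> \<Omega> i" if i: "i \<in> {1..m}" for i
    proof (rule closed_sequentially)
      show "closed (\<Omega> i)" using assms(2) i by blast
      show "x (Suc (k * m + (i - 1))) \<in> \<Omega> i" for k
        using proj[of "k * m + (i - 1)"] i by (auto simp: projection_def)
      have "strict_mono (\<lambda>k. Suc (k * m + (i - 1)))"
        using assms(1) by (intro strict_monoI) auto
      from LIMSEQ_subseq_LIMSEQ[OF l(1) this]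
      show "(\<lambda>k. x (Suc (k * m + (i - 1)))) \<longlonglongrightarrow> l" by (simp add: o_def)
    qed
    moreover have "linearly_converges x l q"
      unfolding linearly_converges_def using q l(2) C'
      by (auto intro!: exI[of _ "C' / (1 - q)"] simp: dist_norm)
    ultimately show ?thesis by (auto simp: q_def)
  qed
  with r(1) show ?thesis by blast
qed

end
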